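(* Let $p$ be an odd prime, $q=p^f$, $m\ge 2$, $\omega$ a primitive element of $\mathbb{F}_{q^m}$, and $N\ge 2$ an odd integer with $N\mid\frac{q^m-1}{q-1}$. Assume that $\mathrm{Cay}(\mathbb{F}_{q^m},C_0^{(N,q^m)})$ is strongly regular and that $-2\in\langle p\rangle\le(\mathbb{Z}/N\mathbb{Z})^\ast$. Let $I\subseteq\mathbb{Z}_N$ be the subdifference set defined below, let $2^{-1}I=\{u\in\mathbb{Z}_N: 2u\in I\}$, and let $$\widehat{X}=\{2t \bmod 2N:\ t\in\{0,\dots,N-1\},\ 4t\bmod N\notin I\}\subseteq\mathbb{Z}_{2N}.$$ Then for every integer $c$, $$2\,\psi\Big(\omega^c\bigcup_{t\in \widehat{X}}C_t^{(2N,q^m)}\Big)-\psi\Big(\omega^c\bigcup_{t\in \mathbb{Z}_N\setminus 2^{-1}I}C_t^{(N,q^m)}\Big)=\begin{cases}0,&\text{if } c \bmod N\in 2^{-1}I,\\ \pm G_{q^m}(\eta),&\text{otherwise,}\end{cases}$$ where $\pm G_{q^m}(\eta)$ means the value is either $G_{q^m}(\eta)$ or $-G_{q^m}(\eta)$.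
   Context: For $M\mid q^m-1$ and an integer $i$, $C_i^{(M,q^m)}=\omega^i\langle\omega^M\rangle$. $\mathrm{Cay}(\mathbb{F}_{q^m},D)$ is the graph on $\mathbb{F}_{q^m}$ with $x\sim y$ iff $x-y\in D$; strongly regular means regular, neither complete nor edgeless, with constant numbers of common neighbours for adjacent and for non-adjacent pairs. $\psi$ is the canonical additive character $\psi(x)=e^{2\pi i\,\mathrm{Tr}_{q^m/p}(x)/p}$, $\psi(A)=\sum_{x\in A}\psi(x)$, $\eta$ is the quadratic character of $\mathbb{F}_{q^m}$ and $G_{q^m}(\eta)=\sum_{x\ne0}\eta(x)\psi(x)$. Subdifference set: for $0\le i\le N-1$ let $n_i=|\{x\in C_i^{(N,q^m)}:\mathrm{Tr}_{q^m/q}(x)=0\}|/(q-1)$; under the hypotheses the $n_i$ take exactly two distinct values, so $n_i-n_0\in\{0,\delta\}$ for a fixed nonzero integer $\delta$, and $I=\{i\in\mathbb{Z}_N: n_i-n_0=\delta\}$. *)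

theory Defs
  imports "HOL-Analysis.Analysis"
begin

definition primitive_element :: "'a::{field,finite} \<Rightarrow> bool" where
  "primitive_element w \<longleftrightarrow> w \<noteq> 0 \<and> (\<forall>x::'a. x \<noteq> 0 \<longrightarrow> (\<exists>k::nat. x = w ^ k))"

definition cyc_class :: "'a::{field,finite} \<Rightarrow> nat \<Rightarrow> int \<Rightarrow> 'a set" where
  "cyc_class w M i = {w powi (i + int M * k) | k::int. True}"

definition rel_trace :: "nat \<Rightarrow> nat \<Rightarrow> 'a::{field,finite} \<Rightarrow> 'a" where
  "rel_trace r e x = (\<Sum>j<e. x ^ (r ^ j))"

text \<open>Canonical additive character; absolute trace Tr_{q^m/p} with q^m = p^(f*m),
  identified with an element of {0..<p}.\<close>
definition add_char :: "nat \<Rightarrow> nat \<Rightarrow> 'a::{field,finite} \<Rightarrow> complex" where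
  "add_char p e x =
     (let k = (THE k::nat. k < p \<and> of_nat k = rel_trace p e x)
      in cis (2 * pi * real k / real p))"

definition add_char_set :: "nat \<Rightarrow> nat \<Rightarrow> 'a::{field,finite} set \<Rightarrow> complex" where
  "add_char_set p e A = (\<Sum>x\<in>A. add_char p e x)"

definition quad_char :: "'a::{field,finite} \<Rightarrow> complex" where
  "quad_char x = (if x = 0 then 0 else if (\<exists>y. x = y ^ 2) then 1 else -1)"

definition gauss_quad :: "nat \<Rightarrow> nat \<Rightarrow> 'a::{field,finite} itself \<Rightarrow> complex" where
  "gauss_quad p e _ = (\<Sum>x\<in>(UNIV::'a set) - {0}. quad_char x * add_char p e x)"

definition srg_cayley :: "'a::{ab_group_add,finite} set \<Rightarrow> bool" where
  "srg_cayley D \<longleftrightarrow>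
     (\<exists>k lam mu :: nat.
        (\<forall>x. card {y. x - y \<in> D} = k) \<and>
        (\<exists>x y. x \<noteq> y \<and> x - y \<in> D) \<and>
        (\<exists>x y. x \<noteq> y \<and> x - y \<notin> D) \<and>
        (\<forall>x y. x \<noteq> y \<and> x - y \<in> D \<longrightarrow> card {z. x - z \<in> D \<and> y - z \<in> D} = lam) \<and>
        (\<forall>x y. x \<noteq> y \<and> x - y \<notin> D \<longrightarrow> card {z. x - z \<in> D \<and> y - z \<in> D} = mu))"

definition sub_n :: "'a::{field,finite} \<Rightarrow> nat \<Rightarrow> nat \<Rightarrow> nat \<Rightarrow> int \<Rightarrow> real" where
  "sub_n w q m N i =
     real (card {x \<in> cyc_class w N i. rel_trace q m x = 0}) / real (q - 1)"

text \<open>Subdifference set I: indices i in Z_N with n_i - n_0 = \<delta>, where \<delta> is the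
  unique nonzero value of n_i - n_0 (the n_i take exactly two values).\<close>
definition subdiff_set :: "'a::{field,finite} \<Rightarrow> nat \<Rightarrow> nat \<Rightarrow> nat \<Rightarrow> int set" where
  "subdiff_set w q m N =
     (let \<delta> = (THE d. d \<noteq> 0 \<and> (\<exists>i\<in>{0..<int N}. sub_n w q m N i - sub_n w q m N 0 = d))
      in {i \<in> {0..<int N}. sub_n w q m N i - sub_n w q m N 0 = \<delta>})"

end

theory Submission
  imports Defs "HOL-Number_Theory.Cong" "HOL-Computational_Algebra.Polynomial"
begin

text \<open>
  Since \<open>N\<close> is odd, the classes of order \<open>2N\<close> indexed by \<open>Xhat\<close> are the squares of the union
  \<open>D\<close> of the classes \<open>C_t\<close> with \<open>2t \<notin> I\<close>, so the left-hand side is \<open>\<Sum>x\<in>D. \<eta>(x) \<psi>(yx)\<close>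
  with \<open>y = \<omega>^c\<close>.

  Let \<open>\<gamma>(y) = \<psi>(y C_0)\<close>. Strong regularity makes \<open>\<gamma>\<close> satisfy an integral quadratic equation, so it
  takes two values \<open>\<gamma>(1)\<close> and \<open>b\<close> on nonzero elements (a single value would be \<open>-1/N\<close>), and \<open>I\<close> is
  where it equals \<open>b\<close>. A power of Frobenius acts as \<open>x \<mapsto> x^(-2)\<close> modulo \<open>C_0\<close>, so
  \<open>\<gamma>(x^2) = \<gamma>(1/x)\<close> and the indicator function of \<open>D\<close> is \<open>(b - \<gamma>(1/x)) / (b - \<gamma>(1))\<close>.

  It remains to evaluate \<open>\<Sum>x. \<eta>(x) \<psi>(x) \<gamma>(y/x)\<close>. Expanding \<open>\<gamma>\<close> gives Salie sums
  \<open>\<Sum>x. \<eta>(x) \<psi>(x + v/x) = G(\<eta>) \<cdot> (\<Sum>z^2=4v. \<psi>(z))\<close>, which replace the Hasse-Davenport product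
  formula; by the Frobenius argument their total over \<open>v \<in> y C_0\<close> is \<open>G(\<eta>) \<gamma>(1/y)\<close>.
\<close>

section \<open>Finite fields\<close>

text \<open>Translation by 1 permutes the ring, so it preserves the sum of all elements while adding
  1 once per element.\<close>

lemma of_nat_CARD_eq_0: "of_nat CARD('a::{ring_1,finite}) = (0::'a)"
proof -
  have "(\<Sum>x\<in>(UNIV::'a set). x + 1) = (\<Sum>x\<in>UNIV. x)"
    by (rule sum.reindex_bij_witness[of _ "\<lambda>y. y - 1" "\<lambda>y. y + 1"]) auto
  then show ?thesis by (simp add: sum.distrib)
qed

lemma power_CARD_minus_1:
  fixes x :: "'a::{field,finite}"
  assumes "x \<noteq> 0"
  shows "x ^ (CARD('a) - 1) = 1"
proof -
  have "(\<Prod>y\<in>UNIV-{0}. x * y) = (\<Prod>y\<in>UNIV-{0}. y)"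
    by (rule prod.reindex_bij_witness[of _ "\<lambda>y. y / x" "\<lambda>y. x * y"]) (use assms in auto)
  moreover have "(\<Prod>y\<in>UNIV-{0}. y) \<noteq> (0::'a)" by simp
  ultimately show ?thesis by (simp add: prod.distrib)
qed

lemma CARD_field_gt_1: "CARD('a::{field,finite}) > 1"
proof -
  have "card {0::'a, 1} \<le> CARD('a)" by (rule card_mono) auto
  then show ?thesis by simp
qed

lemma power_CARD_power:
  fixes x :: "'a::{field,finite}"
  shows "x ^ (CARD('a) ^ k) = x"
proof -
  have *: "y ^ CARD('a) = y" for y :: 'a
  proof (cases "y = 0")
    case False
    then show ?thesis
      using power_CARD_minus_1[of y] CARD_field_gt_1[where 'a='a]
      by (metis One_nat_def Suc_pred less_trans mult_1_right power_Suc zero_less_one)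
  qed simp
  show ?thesis by (induction k) (simp_all add: * power_mult)
qed

lemma CHAR_eq_of_CARD:
  assumes "prime p" "CARD('a::{field,finite}) = p ^ n"
  shows "CHAR('a) = p"
proof -
  have "of_nat p ^ n = (0::'a)"
    using of_nat_CARD_eq_0[where 'a='a] assms(2) by simp
  then have "CHAR('a) dvd p" by (simp add: of_nat_eq_0_iff_char_dvd)
  then show ?thesis
    using assms(1) CHAR_not_1'[where 'a='a] by (auto simp: prime_nat_iff)
qed

text \<open>Exponents reduce modulo \<open>CARD('a) - 1\<close>, so these powers already cover all
  nonzero elements; equal cardinality then forces injectivity.\<close>

lemma primitive_element_inj_on:
  fixes w :: "'a::{field,finite}"
  assumes "primitive_element w"
  shows "inj_on (\<lambda>k. w ^ k) {..<CARD('a) - 1}"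
proof -
  have w: "w \<noteq> 0" using assms by (simp add: primitive_element_def)
  have "UNIV - {0} \<subseteq> (\<lambda>k. w ^ k) ` {..<CARD('a) - 1}"
  proof
    fix x :: 'a assume "x \<in> UNIV - {0}"
    then obtain k where k: "x = w ^ k" using assms by (auto simp: primitive_element_def)
    have "x = (w ^ (CARD('a) - 1)) ^ (k div (CARD('a) - 1)) * w ^ (k mod (CARD('a) - 1))"
      unfolding k by (metis mult_div_mod_eq power_add power_mult)
    then have "x = w ^ (k mod (CARD('a) - 1))" using power_CARD_minus_1[OF w] by simp
    then show "x \<in> (\<lambda>k. w ^ k) ` {..<CARD('a) - 1}"
      using CARD_field_gt_1[where 'a='a] by auto
  qed
  then have eq: "(\<lambda>k. w ^ k) ` {..<CARD('a) - 1} = UNIV - {0}" using w by auto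
  show ?thesis by (rule eq_card_imp_inj_on) (simp, simp only: eq, simp add: card_Diff_subset)
qed

lemma primitive_element_power_eq_1_iff:
  fixes w :: "'a::{field,finite}"
  assumes "primitive_element w"
  shows "w ^ k = 1 \<longleftrightarrow> CARD('a) - 1 dvd k"
proof
  have w: "w \<noteq> 0" using assms by (simp add: primitive_element_def)
  show "w ^ k = 1" if "CARD('a) - 1 dvd k"
    using that power_CARD_minus_1[OF w] by (auto simp: power_mult)
  assume "w ^ k = 1"
  moreover have "w ^ k = (w ^ (CARD('a) - 1)) ^ (k div (CARD('a) - 1)) * w ^ (k mod (CARD('a) - 1))"
    by (metis mult_div_mod_eq power_add power_mult)
  ultimately have "w ^ (k mod (CARD('a) - 1)) = w ^ 0"
    using power_CARD_minus_1[OF w] by simp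
  moreover have "k mod (CARD('a) - 1) < CARD('a) - 1"
    using CARD_field_gt_1[where 'a='a] by simp
  ultimately have "k mod (CARD('a) - 1) = 0"
    by (intro inj_onD[OF primitive_element_inj_on[OF assms]]) auto
  then show "CARD('a) - 1 dvd k" by auto
qed

lemma primitive_element_powi:
  fixes w x :: "'a::{field,finite}"
  assumes "primitive_element w" "x \<noteq> 0"
  obtains k :: int where "x = w powi k"
  using assms by (metis primitive_element_def power_int_of_nat)

text \<open>The additive polynomial \<open>\<Sum>i<n. X^(p^i)\<close> has degree \<open>p^(n-1)\<close>, which bounds its zeros.\<close>

lemma exists_rel_trace_nonzero:
  fixes A :: "'a::{field,finite} set"
  assumes "p \<ge> 2" "n \<ge> 1" "card A \<ge> p ^ n"
  shows "\<exists>x\<in>A. rel_trace p n x \<noteq> 0"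
proof (rule ccontr)
  assume *: "\<not> ?thesis"
  define P :: "'a poly" where "P = (\<Sum>i<n. monom 1 (p ^ i))"
  have deg: "degree P \<le> p ^ (n - 1)" unfolding P_def
    by (rule degree_sum_le) (use assms in \<open>auto intro!: order.trans[OF degree_monom_le] power_increasing\<close>)
  have "coeff P (p ^ (n - 1)) = (\<Sum>i<n. if i = n - 1 then 1 else 0)"
    unfolding P_def coeff_sum by (rule sum.cong) (use assms in auto)
  also have "\<dots> = 1" using assms(2) by simp
  finally have "P \<noteq> 0" by auto
  have "A \<subseteq> {x. poly P x = 0}"
    using * by (auto simp: P_def rel_trace_def poly_sum poly_monom)
  then have "card A \<le> card {x. poly P x = 0}" by (intro card_mono) auto
  also have "\<dots> \<le> p ^ (n - 1)"
    using card_poly_roots_bound[OF \<open>P \<noteq> 0\<close>] deg by linarith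
  also have "\<dots> < p ^ n" using assms by (intro power_strict_increasing) auto
  finally show False using assms(3) by simp
qed

section \<open>The canonical additive character\<close>

locale char_field =
  fixes p n :: nat and w :: "'a::{field,finite}"
  assumes prime_p: "prime p" and odd_p: "odd p" and n_pos: "n \<ge> 1"
    and CARD_eq: "CARD('a) = p ^ n" and prim: "primitive_element w"
begin

abbreviation psi :: "'a \<Rightarrow> complex" where "psi \<equiv> add_char p n"
abbreviation Tr :: "'a \<Rightarrow> 'a" where "Tr \<equiv> rel_trace p n"

lemma p_ge_2: "p \<ge> 2" using prime_p by (rule prime_ge_2_nat)

lemma w_nonzero: "w \<noteq> 0" using prim by (simp add: primitive_element_def)

lemma CHAR_eq: "CHAR('a) = p"
  using prime_p CARD_eq by (rule CHAR_eq_of_CARD)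

lemma two_nonzero: "(2::'a) \<noteq> 0"
proof
  assume "(2::'a) = 0"
  then have "of_nat 2 = (0::'a)" by simp
  then have "p dvd 2" by (metis of_nat_eq_0_iff_char_dvd CHAR_eq)
  then have "p = 2" using p_ge_2 by (auto dest: dvd_imp_le)
  then show False using odd_p by simp
qed

lemma four_nonzero: "(4::'a) \<noteq> 0"
  using two_nonzero mult_eq_0_iff[of "2::'a" 2] by simp

lemma frob_add: "(x + y :: 'a) ^ (p ^ k) = x ^ (p ^ k) + y ^ (p ^ k)"
  by (rule freshmans_dream') (use CHAR_eq prime_p in auto)

lemma frob_sum: "(sum g A :: 'a) ^ (p ^ k) = (\<Sum>i\<in>A. g i ^ (p ^ k))"
  by (rule freshmans_dream_sum') (use CHAR_eq prime_p in auto)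

lemma rel_trace_add: "rel_trace (p ^ k) e (x + y :: 'a) = rel_trace (p ^ k) e x + rel_trace (p ^ k) e y"
  by (simp add: rel_trace_def frob_add sum.distrib flip: power_mult)

lemma frob_inj: "inj (\<lambda>x::'a. x ^ (p ^ k))"
proof (rule injI)
  fix x y :: 'a
  assume eq: "x ^ (p ^ k) = y ^ (p ^ k)"
  have "((x - y) + y) ^ (p ^ k) = (x - y) ^ (p ^ k) + y ^ (p ^ k)" by (rule frob_add)
  then have "(x - y) ^ (p ^ k) = 0" using eq by simp
  then show "x = y" by simp
qed

text \<open>Raising to the power \<open>r\<close> shifts the summands by one place, and the
  assumption closes the cycle.\<close>

lemma rel_trace_frob:
  fixes x :: 'a
  assumes "x ^ (r ^ e) = x"
  shows "rel_trace r e (x ^ r) = rel_trace r e x"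
proof -
  have "rel_trace r e (x ^ r) = (\<Sum>j<e. x ^ (r ^ Suc j))"
    by (simp add: rel_trace_def flip: power_mult power_Suc)
  also have "\<dots> + x ^ (r ^ 0) = (\<Sum>j<Suc e. x ^ (r ^ j))"
    by (subst sum.lessThan_Suc_shift) simp
  also have "\<dots> = rel_trace r e x + x" by (simp add: rel_trace_def assms)
  finally show ?thesis by simp
qed

lemma rel_trace_power:
  fixes x :: 'a
  assumes "x ^ ((p ^ k) ^ e) = x"
  shows "rel_trace (p ^ k) e x ^ (p ^ k) = rel_trace (p ^ k) e x"
proof -
  have "rel_trace (p ^ k) e x ^ (p ^ k) = rel_trace (p ^ k) e (x ^ (p ^ k))"
    by (simp add: rel_trace_def frob_sum mult.commute flip: power_mult)
  then show ?thesis by (simp add: rel_trace_frob[OF assms])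
qed

lemma of_nat_eq_iff_cong: "of_nat j = (of_nat k :: 'a) \<longleftrightarrow> j mod p = k mod p"
  using of_nat_eq_iff_cong_CHAR[of j k, where 'a='a] by (simp add: CHAR_eq cong_def)

text \<open>The polynomial \<open>X^p - X\<close> has at most \<open>p\<close> roots, and the
  \<open>p\<close> elements of the prime field, roots by Fermat's little theorem, exhaust
  them.\<close>

lemma frob_fixed:
  assumes "x ^ p = (x::'a)"
  shows "\<exists>k<p. x = of_nat k"
proof -
  define P :: "'a poly" where "P = monom 1 p - monom 1 1"
  have "coeff P p = 1" using p_ge_2 by (simp add: P_def)
  then have P: "P \<noteq> 0" by auto
  have "degree P \<le> p" unfolding P_def
    by (intro degree_diff_le order.trans[OF degree_monom_le]) (use p_ge_2 in auto)
  then have "card {x. poly P x = 0} \<le> p" using card_poly_roots_bound[OF P] by linarith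
  moreover have sub: "of_nat ` {..<p} \<subseteq> {x. poly P x = 0}"
  proof -
    have "of_nat k ^ p = (of_nat k :: 'a)" for k
    proof (induction k)
      case (Suc k)
      then show ?case using frob_add[of 1 "of_nat k" 1] by simp
    qed (use p_ge_2 in simp)
    then show ?thesis by (auto simp: P_def poly_monom)
  qed
  moreover have "card (of_nat ` {..<p} :: 'a set) = p"
    by (subst card_image) (auto simp: inj_on_def of_nat_eq_iff_cong)
  ultimately have "of_nat ` {..<p} = {x. poly P x = 0}"
    by (intro card_seteq) auto
  moreover have "poly P x = 0" using assms by (simp add: P_def poly_monom)
  ultimately show ?thesis by blast
qed

lemma power_CARD: "x ^ (p ^ n) = (x::'a)"
  using power_CARD_power[of x 1] by (simp add: CARD_eq)

lemma Tr_add: "Tr (x + y) = Tr x + Tr y"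
  using rel_trace_add[of 1 n x y] by simp

lemma Tr_frob: "Tr (x ^ (p ^ k)) = Tr x"
proof (induction k)
  case (Suc k)
  have "Tr ((x ^ (p ^ k)) ^ p) = Tr (x ^ (p ^ k))" by (rule rel_trace_frob) (rule power_CARD)
  then show ?case using Suc by (simp add: mult.commute flip: power_mult)
qed simp

lemma Tr_eq_of_nat: "\<exists>k<p. Tr x = of_nat k"
  using rel_trace_power[of x 1 n] power_CARD[of x] by (intro frob_fixed) simp

text \<open>Any representative \<open>k\<close> of the trace is allowed, not only the reduced one in
  the definition; additivity needs this because a sum of representatives may exceed
  \<open>p\<close>.\<close>

lemma psi_eq:
  assumes "Tr x = of_nat k"
  shows "psi x = cis (2 * pi * real k / real p)"
proof -
  have "(THE k. k < p \<and> of_nat k = Tr x) = k mod p"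
    using p_ge_2 by (intro the_equality) (auto simp: assms of_nat_eq_iff_cong)
  then have "psi x = cis (2 * pi * real (k mod p) / real p)" by (simp add: add_char_def)
  also have "\<dots> = cis (2 * pi * real (k mod p) / real p + 2 * pi * real (k div p))"
    by (simp add: cis_mult[symmetric] cis_multiple_2pi)
  also have "2 * pi * real (k mod p) / real p + 2 * pi * real (k div p) = 2 * pi * real k / real p"
  proof -
    have "real k = real (k mod p) + real p * real (k div p)"
      by (metis mod_mult_div_eq of_nat_add of_nat_mult)
    then show ?thesis using p_ge_2 by (simp only:) (simp add: field_simps)
  qed
  finally show ?thesis .
qed

lemma psi_add: "psi (x + y) = psi x * psi y"
proof -
  obtain j k where j: "Tr x = of_nat j" and k: "Tr y = of_nat k" using Tr_eq_of_nat by blast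
  then have "Tr (x + y) = of_nat (j + k)" by (simp add: Tr_add)
  then show ?thesis
    unfolding psi_eq[OF j] psi_eq[OF k]
    by (simp add: psi_eq[of "x + y" "j + k"] cis_mult add_divide_distrib ring_distribs)
qed

lemma psi_frob: "psi (x ^ (p ^ k)) = psi x"
  unfolding add_char_def Tr_frob ..

lemma psi_0: "psi 0 = 1"
  using psi_eq[of 0 0] p_ge_2 by (simp add: rel_trace_def power_0_left)

lemma psi_neq_1: "Tr x \<noteq> 0 \<Longrightarrow> psi x \<noteq> 1"
proof
  assume x: "Tr x \<noteq> 0" "psi x = 1"
  obtain k where k: "k < p" "Tr x = of_nat k" using Tr_eq_of_nat by blast
  with x have "k > 0" by (cases k) auto
  have "cis (2 * pi * real k / real p) = 1" using psi_eq[OF k(2)] x by simp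
  then have "cos (2 * pi * real k / real p) = 1" by (metis cis.simps(1) one_complex.simps(1))
  then obtain i :: int where i: "2 * pi * real k / real p = 2 * pi * of_int i"
    by (auto simp: cos_one_2pi_int mult_ac)
  then have "real k = real p * of_int i" using p_ge_2 by (simp add: field_simps)
  then have "int k = int p * i" by (metis of_int_eq_iff of_int_mult of_int_of_nat_eq)
  then have "p dvd k" by (metis dvd_triv_left int_dvd_int_iff)
  then show False using k \<open>k > 0\<close> by (auto dest: dvd_imp_le)
qed

text \<open>Translation by \<open>z\<close> permutes the finite set \<open>A\<close> and multiplies
  the sum by \<open>psi z\<close>, which differs from 1.\<close>

lemma sum_psi_eq_0:
  assumes "\<And>x y. x \<in> A \<Longrightarrow> y \<in> A \<Longrightarrow> x + y \<in> A" and "z \<in> A" "Tr z \<noteq> 0"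
  shows "sum psi A = 0"
proof -
  have "(\<lambda>x. z + x) ` A = A"
    by (rule endo_inj_surj) (use assms in auto)
  then have "sum psi A = (\<Sum>x\<in>A. psi (z + x))"
    using sum.reindex[of "\<lambda>x. z + x" A psi] by (simp add: o_def)
  also have "\<dots> = psi z * sum psi A" by (simp add: psi_add sum_distrib_left)
  finally show ?thesis using psi_neq_1[OF assms(3)] by simp
qed

lemma sum_psi_UNIV: "sum psi UNIV = 0"
proof -
  obtain z :: 'a where "Tr z \<noteq> 0"
    using exists_rel_trace_nonzero[of p n "UNIV :: 'a set"] p_ge_2 n_pos CARD_eq by auto
  then show ?thesis by (intro sum_psi_eq_0) auto
qed

lemma sum_psi_mult_UNIV:
  assumes "y \<noteq> 0"
  shows "(\<Sum>x\<in>UNIV. psi (y * x)) = 0"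
proof -
  have "(\<Sum>x\<in>UNIV. psi (y * x)) = sum psi UNIV"
    by (rule sum.reindex_bij_witness[of _ "\<lambda>x. x / y" "\<lambda>x. y * x"]) (use assms in auto)
  then show ?thesis by (simp add: sum_psi_UNIV)
qed

lemma sum_psi_scaled:
  assumes "y \<noteq> 0"
  shows "(\<Sum>x\<in>UNIV - {0}. psi (y * x)) = -1"
  using sum_psi_mult_UNIV[OF assms] sum.remove[of UNIV "0::'a" "\<lambda>x. psi (y * x)"]
  by (simp add: psi_0 eq_neg_iff_add_eq_0 add.commute)

text \<open>Since \<open>w\<close> has order \<open>d * e\<close>, a power \<open>w ^ k\<close> is a
  root exactly when \<open>e\<close> divides \<open>k\<close>. Applied with \<open>d = h\<close> for
  \<open>H\<close> and with \<open>d = q - 1\<close> for the units of \<open>K\<close>.\<close>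

lemma roots_of_unity_eq:
  assumes "d * e = p ^ n - 1"
  shows "{x::'a. x ^ d = 1} = (\<lambda>k. w ^ (e * k)) ` {..<d}" (is "?A = ?B")
    and "card {x::'a. x ^ d = 1} = d"
proof -
  have pn: "p ^ n - 1 > 0" using CARD_field_gt_1[where 'a='a] CARD_eq by simp
  then have d: "d > 0" and e: "e > 0" using assms by (metis mult_is_0 not_gr_zero)+
  show eq: "?A = ?B"
  proof (intro equalityI subsetI)
    fix x assume "x \<in> ?B"
    then obtain k where "x = w ^ (e * k)" by blast
    then have "x ^ d = (w ^ (p ^ n - 1)) ^ k" by (metis assms mult.assoc mult.commute power_mult)
    then show "x \<in> ?A" using power_CARD_minus_1[OF w_nonzero] CARD_eq by simp
  next
    fix x assume x: "x \<in> ?A"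
    with d have "x \<noteq> 0" by (auto simp: power_0_left)
    then obtain k where k: "x = w ^ k" using prim by (auto simp: primitive_element_def)
    then have "w ^ (k * d) = 1" using x by (simp add: power_mult)
    then have "d * e dvd d * k"
      using primitive_element_power_eq_1_iff[OF prim] CARD_eq assms by (simp add: mult.commute)
    then have "e dvd k" using d by simp
    then obtain l where l: "k = e * l" ..
    have "l = d * (l div d) + l mod d" by simp
    then have "e * l = (p ^ n - 1) * (l div d) + e * (l mod d)"
      by (metis assms mult.assoc mult.commute distrib_left)
    then have "x = w ^ (e * (l mod d))"
      using power_CARD_minus_1[OF w_nonzero] CARD_eq by (simp add: k l power_add power_mult)
    then show "x \<in> ?B" using d by auto
  qed
  have "inj_on (\<lambda>k. w ^ (e * k)) {..<d}"
  proof (rule inj_onI)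
    fix i j assume ij: "i \<in> {..<d}" "j \<in> {..<d}" "w ^ (e * i) = w ^ (e * j)"
    then have "e * i < CARD('a) - 1" "e * j < CARD('a) - 1"
      using e unfolding CARD_eq assms[symmetric] by (simp_all add: mult.commute[of d])
    then have "e * i = e * j"
      using ij(3) by (intro inj_onD[OF primitive_element_inj_on[OF prim]]) auto
    then show "i = j" using e by simp
  qed
  then show "card {x::'a. x ^ d = 1} = d" unfolding eq by (simp add: card_image)
qed

section \<open>The quadratic character and the Salie sum\<close>

lemma quad_char_power2: "x \<noteq> 0 \<Longrightarrow> quad_char (x ^ 2 :: 'a) = 1"
  by (auto simp: quad_char_def)

lemma quad_char_cases: "(x::'a) \<noteq> 0 \<Longrightarrow> quad_char x = 1 \<or> quad_char x = -1"
  by (simp add: quad_char_def)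

text \<open>A nonzero square factor does not affect being a square, and two nonsquares are odd
  powers of \<open>w\<close>, so their product is an even power.\<close>

lemma quad_char_mult: "quad_char (x * y :: 'a) = quad_char x * quad_char y"
proof (cases "x = 0 \<or> y = 0")
  case False
  have square_mult: "(\<exists>r. u * v = r ^ 2) \<longleftrightarrow> (\<exists>r. v = r ^ 2)"
    if u: "u \<noteq> 0" "\<exists>r. u = r ^ 2" for u v :: 'a
  proof -
    obtain s where s: "u = s ^ 2" using u by blast
    then have "s \<noteq> 0" using u by auto
    have "v = (r / s) ^ 2" if "u * v = r ^ 2" for r
      using that s \<open>s \<noteq> 0\<close> by (simp add: field_simps power_divide)
    moreover have "u * r ^ 2 = (s * r) ^ 2" for r by (simp add: s power_mult_distrib)
    ultimately show ?thesis by metis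
  qed
  have nonsq: "\<exists>r. u * v = r ^ 2"
    if uv: "u \<noteq> 0" "v \<noteq> 0" "\<nexists>r. u = r ^ 2" "\<nexists>r. v = r ^ 2" for u v :: 'a
  proof -
    obtain i j where ij: "u = w ^ i" "v = w ^ j"
      using prim uv by (meson primitive_element_def)
    have square: "w ^ k = (w ^ (k div 2)) ^ 2" if "even k" for k
      using that by (simp flip: power_mult)
    have "odd i" using uv(3) square[of i] unfolding ij by blast
    moreover have "odd j" using uv(4) square[of j] unfolding ij by blast
    ultimately have "even (i + j)" by simp
    then obtain k where "i + j = 2 * k" ..
    then have "u * v = (w ^ k) ^ 2" by (simp add: ij mult.commute flip: power_add power_mult)
    then show ?thesis by blast
  qed
  show ?thesis
    using False square_mult[of x y] square_mult[of y x] nonsq[of x y]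
    by (auto simp: quad_char_def mult.commute)
qed (auto simp: quad_char_def)

lemma quad_char_mult_eq_square:
  assumes "x * y = (r::'a) ^ 2" "r \<noteq> 0"
  shows "quad_char x = quad_char y"
proof -
  have "x \<noteq> 0" "y \<noteq> 0" using assms by auto
  moreover have "quad_char x * quad_char y = 1"
    using assms quad_char_power2[of r] quad_char_mult[of x y] by simp
  ultimately show ?thesis using quad_char_cases[of x] quad_char_cases[of y] by auto
qed

lemma quad_char_divide: "quad_char (x / y :: 'a) = quad_char x * quad_char y"
proof (cases "x = 0 \<or> y = 0")
  case False
  have "quad_char (x / y) = quad_char (x * y)"
    by (rule quad_char_mult_eq_square[of _ _ x]) (use False in \<open>auto simp: power2_eq_square\<close>)
  then show ?thesis by (simp add: quad_char_mult)
qed (auto simp: quad_char_def)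

lemma gauss_scaled:
  assumes "u \<noteq> 0"
  shows "(\<Sum>s\<in>UNIV. quad_char s * psi (u * s)) = quad_char u * gauss_quad p n TYPE('a)"
proof -
  have "(\<Sum>s\<in>UNIV. quad_char s * psi (u * s)) = (\<Sum>x\<in>UNIV. quad_char (x / u) * psi x)"
    by (rule sum.reindex_bij_witness[of _ "\<lambda>x. x / u" "\<lambda>s. u * s"]) (use assms in auto)
  also have "\<dots> = (\<Sum>x\<in>UNIV - {0}. quad_char (x / u) * psi x)"
    by (rule sum.mono_neutral_right) (auto simp: quad_char_def)
  also have "\<dots> = quad_char u * gauss_quad p n TYPE('a)"
    by (simp add: quad_char_divide gauss_quad_def sum_distrib_left mult_ac)
  finally show ?thesis .
qed

text \<open>If \<open>t + 1/t = s\<close> then \<open>(s \<plusminus> 2) t = (t \<plusminus> 1)^2\<close>, so \<open>t\<close>, \<open>s + 2\<close>, \<open>s - 2\<close> have the same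
  quadratic character whenever \<open>s \<noteq> \<plusminus>2\<close>.\<close>

lemma sum_quad_char_fibre:
  "(\<Sum>t\<in>{t \<in> UNIV - {0}. t + 1 / t = s}. quad_char t) = quad_char (s + 2) + quad_char (s - 2 :: 'a)"
  (is "sum _ ?A = _")
proof -
  have two: "(2::'a) \<noteq> 0" by (rule two_nonzero)
  have four: "(4::'a) \<noteq> 0" by (rule four_nonzero)
  have mem: "t \<in> ?A \<longleftrightarrow> t ^ 2 + 1 = s * t" for t
    by (cases "t = 0") (auto simp: field_simps power2_eq_square)
  \<comment> \<open>Completing the square: the discriminant \<open>s ^ 2 - 4\<close> governs the
    fibre.\<close>
  have mem': "t \<in> ?A \<longleftrightarrow> (2 * t - s) ^ 2 = s ^ 2 - 4" for t
  proof -
    have "(2 * t - s) ^ 2 - (s ^ 2 - 4) = 4 * (t ^ 2 + 1 - s * t)"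
      by (simp add: power2_eq_square algebra_simps)
    then show ?thesis unfolding mem using four by (metis eq_iff_diff_eq_0 mult_eq_0_iff)
  qed
  have q4: "quad_char (4::'a) = 1" using quad_char_power2[OF two] by simp
  have q1: "quad_char (1::'a) = 1" using quad_char_power2[of 1] by simp
  \<comment> \<open>The discriminant is zero (first two cases), a nonzero square, or a nonsquare;
    the fibre has one, two or no elements accordingly.\<close>
  consider "s = 2" | "s = -2" | r where "s ^ 2 - 4 = r ^ 2" "r \<noteq> 0"
    | "s \<noteq> 2" "s \<noteq> -2" "\<nexists>r. s ^ 2 - 4 = r ^ 2"
  proof (cases "\<exists>r. s ^ 2 - 4 = r ^ 2")
    case True
    then obtain r where r: "s ^ 2 - 4 = r ^ 2" by blast
    show ?thesis
    proof (cases "r = 0")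
      case True
      then have "s ^ 2 = 2 ^ 2" using r by simp
      then have "s = 2 \<or> s = - 2" by (rule iffD1[OF power2_eq_iff])
      then show ?thesis using that(1,2) by blast
    qed (use that(3) r in blast)
  next
    case False
    have "s ^ 2 - 4 = 0 ^ 2" if "s = 2 \<or> s = -2" using that by auto
    then show ?thesis using that(4) False by blast
  qed
  then show ?thesis
  proof cases
    case 1
    have "t \<in> ?A \<longleftrightarrow> t = 1" for t
    proof -
      have "t ^ 2 + 1 - s * t = (t - 1) ^ 2" by (simp add: 1 power2_eq_square algebra_simps)
      then show ?thesis unfolding mem by (metis eq_iff_diff_eq_0 zero_eq_power2)
    qed
    then have "?A = {1}" by blast
    then show ?thesis using 1 q1 q4 by (simp add: quad_char_def[of 0])
  next
    case 2
    have "t \<in> ?A \<longleftrightarrow> t = -1" for t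
    proof -
      have "t ^ 2 + 1 - s * t = (t + 1) ^ 2" by (simp add: 2 power2_eq_square algebra_simps)
      then show ?thesis unfolding mem by (metis eq_iff_diff_eq_0 zero_eq_power2 add_eq_0_iff2)
    qed
    then have A: "?A = {-1}" by blast
    have "quad_char (-4::'a) = quad_char (-1 :: 'a)" using quad_char_mult[of "-1::'a" 4] q4 by simp
    then show ?thesis unfolding A using 2 by (simp add: quad_char_def[of 0])
  next
    case (3 r)
    have s: "s + 2 \<noteq> 0" "s - 2 \<noteq> 0"
      using 3 by (auto simp: add_eq_0_iff2)
    have q: "quad_char t = quad_char (s + 2)" "quad_char t = quad_char (s - 2)" if "t \<in> ?A" for t
    proof -
      have e: "t ^ 2 + 1 = s * t" using that mem by blast
      have *: "t * (s + 2) = (t + 1) ^ 2" "t * (s - 2) = (t - 1) ^ 2"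
        using e by (simp_all add: power2_eq_square algebra_simps)
      moreover have "t \<noteq> 0" using that by blast
      ultimately have "t + 1 \<noteq> 0" "t - 1 \<noteq> 0" using s by (metis mult_eq_0_iff zero_power2)+
      then show "quad_char t = quad_char (s + 2)" "quad_char t = quad_char (s - 2)"
        using * quad_char_mult_eq_square by blast+
    qed
    have "t \<in> ?A \<longleftrightarrow> t = (s + r) / 2 \<or> t = (s - r) / 2" for t
    proof -
      have "t \<in> ?A \<longleftrightarrow> 2 * t - s = r \<or> 2 * t - s = - r" unfolding mem' 3 by (rule power2_eq_iff)
      also have "\<dots> \<longleftrightarrow> t = (s + r) / 2 \<or> t = (s - r) / 2"
        using two by (auto simp: field_simps)
      finally show ?thesis .
    qed
    then have A: "?A = {(s + r) / 2, (s - r) / 2}" by blast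
    have "(s + r) / 2 \<noteq> (s - r) / 2"
    proof
      assume "(s + r) / 2 = (s - r) / 2"
      then have "2 * r = 0" using two four by (simp add: field_simps)
      then show False using two 3 by simp
    qed
    then have "sum quad_char ?A = quad_char ((s + r) / 2) + quad_char ((s - r) / 2)"
      unfolding A by simp
    also have "\<dots> = quad_char (s + 2) + quad_char (s - 2)"
    proof -
      have "(s + r) / 2 \<in> ?A" "(s - r) / 2 \<in> ?A" unfolding A by simp_all
      from q(1)[OF this(1)] q(2)[OF this(2)] show ?thesis by (simp only:)
    qed
    finally show ?thesis .
  next
    case 4
    have "?A = {}" using mem' 4 by (metis all_not_in_conv)
    \<comment> \<open>The product is a nonsquare, so the two characters on the right cancel,
      matching the empty fibre.\<close>
    have "(s + 2) * (s - 2) = s ^ 2 - 4" by (simp add: power2_eq_square algebra_simps)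
    moreover have ne: "s + 2 \<noteq> 0" "s - 2 \<noteq> 0" using 4 by (auto simp: add_eq_0_iff2)
    ultimately have "quad_char (s + 2) * quad_char (s - 2) = -1"
      using 4 quad_char_mult[of "s + 2" "s - 2"] by (metis quad_char_def mult_eq_0_iff)
    then show ?thesis unfolding \<open>?A = {}\<close>
      using quad_char_cases[OF ne(1)] quad_char_cases[OF ne(2)] by auto
  qed
qed

text \<open>Grouping the terms by \<open>s = t + 1 / t\<close> leaves two Gauss sums shifted by 2
  and -2; undoing the shifts produces the two factors \<open>psi\<close>.\<close>

lemma salie_square:
  assumes "u \<noteq> 0"
  shows "(\<Sum>t\<in>UNIV - {0}. quad_char t * psi (u * (t + 1 / t)))
    = quad_char u * gauss_quad p n TYPE('a) * (psi (2 * u) + psi (- 2 * u))"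
proof -
  have "(\<Sum>t\<in>UNIV - {0}. quad_char t * psi (u * (t + 1 / t)))
      = (\<Sum>s\<in>UNIV. \<Sum>t\<in>{t \<in> UNIV - {0}. t + 1 / t = s}. quad_char t * psi (u * (t + 1 / t)))"
    by (rule sum.group[symmetric]) auto
  also have "\<dots> = (\<Sum>s\<in>UNIV. (\<Sum>t\<in>{t \<in> UNIV - {0}. t + 1 / t = s}. quad_char t) * psi (u * s))"
    unfolding sum_distrib_right by (intro sum.cong refl) auto
  also have "\<dots> = (\<Sum>s\<in>UNIV. quad_char (s + 2) * psi (u * s)) + (\<Sum>s\<in>UNIV. quad_char (s - 2) * psi (u * s))"
    unfolding sum_quad_char_fibre by (simp add: distrib_right sum.distrib)
  also have "(\<Sum>s\<in>UNIV. quad_char (s + 2) * psi (u * s)) = (\<Sum>s\<in>UNIV. quad_char s * psi (u * s + - 2 * u))"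
    by (rule sum.reindex_bij_witness[of _ "\<lambda>s. s - 2" "\<lambda>s. s + 2"]) (auto simp: algebra_simps)
  also have "(\<Sum>s\<in>UNIV. quad_char (s - 2) * psi (u * s)) = (\<Sum>s\<in>UNIV. quad_char s * psi (u * s + 2 * u))"
    by (rule sum.reindex_bij_witness[of _ "\<lambda>s. s + 2" "\<lambda>s. s - 2"]) (auto simp: algebra_simps)
  finally show ?thesis
    unfolding psi_add mult.assoc[symmetric] sum_distrib_right[symmetric] gauss_scaled[OF assms]
    by (simp add: algebra_simps)
qed

text \<open>If \<open>v = u ^ 2\<close>, substitute \<open>x = u * t\<close>. If \<open>v\<close> is
  a nonsquare, \<open>x \<mapsto> v / x\<close> fixes \<open>x + v / x\<close> and negates
  \<open>quad_char x\<close>, so the left side vanishes, and the right side is an empty sum.\<close>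

lemma salie:
  assumes "v \<noteq> 0"
  shows "(\<Sum>x\<in>UNIV - {0}. quad_char x * psi (x + v / x)) = gauss_quad p n TYPE('a) * (\<Sum>z\<in>{z. z ^ 2 = 4 * v}. psi z)"
proof (cases "\<exists>u. v = u ^ 2")
  case True
  then obtain u where u: "v = u ^ 2" by blast
  with assms have "u \<noteq> 0" by auto
  have uu: "quad_char u * quad_char u = 1" using quad_char_cases[OF \<open>u \<noteq> 0\<close>] by auto
  have key: "quad_char u * (quad_char (x / u) * psi (u * (x / u + 1 / (x / u)))) = quad_char x * psi (x + v / x)" for x
  proof -
    have "quad_char u * quad_char (x / u) = quad_char x"
      using uu by (simp add: quad_char_divide)
    moreover have "u * (x / u + 1 / (x / u)) = x + v / x"
      using \<open>u \<noteq> 0\<close> by (simp add: u distrib_left power2_eq_square)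
    ultimately show ?thesis by (metis mult.assoc)
  qed
  have "(\<Sum>x\<in>UNIV - {0}. quad_char x * psi (x + v / x))
      = (\<Sum>t\<in>UNIV - {0}. quad_char u * (quad_char t * psi (u * (t + 1 / t))))"
    by (rule sum.reindex_bij_witness[of _ "\<lambda>t. u * t" "\<lambda>x. x / u"])
      (use \<open>u \<noteq> 0\<close> key in auto)
  also have "\<dots> = (quad_char u * quad_char u) * gauss_quad p n TYPE('a) * (psi (2 * u) + psi (- 2 * u))"
    by (simp add: salie_square[OF \<open>u \<noteq> 0\<close>] flip: sum_distrib_left)
  also note uu
  also have "psi (2 * u) + psi (- 2 * u) = (\<Sum>z\<in>{2 * u, - 2 * u}. psi z)"
  proof -
    have "2 * u \<noteq> - 2 * u"
    proof
      assume "2 * u = - 2 * u"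
      then have "4 * u = 0" by (simp add: eq_neg_iff_add_eq_0)
      then show False using four_nonzero \<open>u \<noteq> 0\<close> by simp
    qed
    then show ?thesis by simp
  qed
  also have "{2 * u, - 2 * u} = {z. z ^ 2 = 4 * v}"
  proof -
    have "z \<in> {2 * u, - 2 * u} \<longleftrightarrow> z \<in> {z. z ^ 2 = 4 * v}" for z
      using power2_eq_iff[of z "2 * u"] by (simp add: u power_mult_distrib)
    then show ?thesis by blast
  qed
  finally show ?thesis by simp
next
  case False
  then have v: "quad_char v = -1" using assms by (simp add: quad_char_def)
  let ?S = "\<Sum>x\<in>UNIV - {0}. quad_char x * psi (x + v / x)"
  have "?S = (\<Sum>x\<in>UNIV - {0}. - (quad_char x * psi (x + v / x)))"
    by (rule sum.reindex_bij_witness[of _ "\<lambda>x. v / x" "\<lambda>x. v / x"])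
      (use assms v in \<open>auto simp: quad_char_divide add.commute\<close>)
  then have "?S = 0" by (simp add: sum_negf)
  moreover have "{z. z ^ 2 = 4 * v} = {}"
  proof -
    have "v = (z / 2) ^ 2" if "z ^ 2 = 4 * v" for z
      using that four_nonzero by (simp add: power_divide)
    then show ?thesis using False by blast
  qed
  ultimately show ?thesis by simp
qed

end

section \<open>Subgroups and periods\<close>

locale cyclotomic = char_field +
  fixes q f m N :: nat
  assumes f_pos: "f \<ge> 1" and q_eq: "q = p ^ f" and m_ge_2: "m \<ge> 2" and n_eq: "n = f * m"
    and odd_N: "odd N" and N_ge_2: "N \<ge> 2" and N_dvd: "N dvd (q ^ m - 1) div (q - 1)"
begin

text \<open>\<open>H\<close> is the class \<open>C_0^(N, q^m)\<close>, given as the group of \<open>h\<close>-th roots of unity so that its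
  closure properties are immediate; \<open>\<gamma> y\<close> is the Gauss period \<open>\<psi>(y C_0)\<close>, and below \<open>K\<close> is the
  subfield of order \<open>q\<close>.\<close>

definition h :: nat where "h = (p ^ n - 1) div N"
definition H :: "'a set" where "H = {x. x ^ h = 1}"
definition \<gamma> :: "'a \<Rightarrow> complex" where "\<gamma> y = (\<Sum>z\<in>H. psi (y * z))"

lemma q_ge_2: "q \<ge> 2"
  using p_ge_2 f_pos q_eq self_le_power[of p f] by linarith

lemma card_eq_qm: "p ^ n = q ^ m"
  by (simp add: n_eq q_eq power_mult)

lemma q_minus_1_dvd: "q - 1 dvd q ^ m - 1"
proof -
  have "int (q ^ m - 1) = int (q - 1) * (\<Sum>i<m. int q ^ i)"
    using power_diff_1_eq[of "int q" m] q_ge_2 m_ge_2 by (simp add: of_nat_diff)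
  then show ?thesis by (metis dvd_triv_left int_dvd_int_iff)
qed

text \<open>Divisibility of \<open>h\<close> by \<open>q - 1\<close> places the nonzero elements of
  the subfield of order \<open>q\<close> inside \<open>H\<close>.\<close>

lemma h_mult_N: "h * N = p ^ n - 1" and q_minus_1_dvd_h: "q - 1 dvd h"
proof -
  obtain k where k: "q ^ m - 1 = (q - 1) * k" using q_minus_1_dvd by (rule dvdE)
  then have "(q ^ m - 1) div (q - 1) = k" using q_ge_2 by simp
  then obtain l where l: "k = N * l" using N_dvd by auto
  have "p ^ n - 1 = N * ((q - 1) * l)" using k l by (simp add: card_eq_qm)
  then show "h * N = p ^ n - 1" "q - 1 dvd h" using N_ge_2 by (auto simp: h_def)
qed

lemma pn_gt_1: "p ^ n > 1"
  using CARD_field_gt_1[where 'a='a] CARD_eq by simp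

lemma h_pos: "h > 0"
  using h_mult_N pn_gt_1 by (cases "h = 0") auto

lemma card_H: "card H = h"
  unfolding H_def by (rule roots_of_unity_eq(2)[OF h_mult_N])

lemma zero_notin_H: "0 \<notin> H"
  using h_pos by (simp add: H_def power_0_left)

lemma one_in_H: "1 \<in> H" by (simp add: H_def)

lemma H_mult: "x \<in> H \<Longrightarrow> y \<in> H \<Longrightarrow> x * y \<in> H"
  by (simp add: H_def power_mult_distrib)

lemma H_divide: "x \<in> H \<Longrightarrow> y \<in> H \<Longrightarrow> x / y \<in> H"
  by (simp add: H_def power_divide)

lemma H_power: "x \<in> H \<Longrightarrow> x ^ k \<in> H"
  by (simp add: H_def power_commutes mult.commute[of k] flip: power_mult) (simp add: power_mult)

lemma H_subfield: "x \<noteq> 0 \<Longrightarrow> x ^ q = x \<Longrightarrow> x \<in> H"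
proof -
  assume "x \<noteq> 0" "x ^ q = x"
  moreover have "x ^ q = x * x ^ (q - 1)" using q_ge_2 by (simp flip: power_Suc)
  ultimately have "x ^ (q - 1) = 1" by simp
  then show "x \<in> H" using q_minus_1_dvd_h by (auto simp: H_def power_mult)
qed

text \<open>As \<open>p ^ n - 1 = h * N\<close> is even and \<open>N\<close> is odd,
  \<open>h\<close> is even, so -1 lies in \<open>H\<close>.\<close>

lemma H_minus: "- x \<in> H \<longleftrightarrow> x \<in> H"
proof -
  have "even (h * N)" unfolding h_mult_N using odd_p p_ge_2 by simp
  then show ?thesis using odd_N by (simp add: H_def)
qed

text \<open>The element 4 lies in the prime field. The factor 4 from the Salie sum can therefore be
  absorbed into \<open>H\<close>.\<close>

lemma four_in_H: "4 \<in> H"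
proof (rule H_subfield[OF four_nonzero])
  have "of_nat k ^ q = (of_nat k :: 'a)" for k
  proof (induction k)
    case (Suc k)
    then show ?case using frob_add[of 1 "of_nat k" f] by (simp add: q_eq)
  qed (use q_ge_2 in simp)
  from this[of 4] show "4 ^ q = (4::'a)" by simp
qed

lemma power_N_in_H: "x \<noteq> 0 \<Longrightarrow> x ^ N \<in> H"
  using power_CARD_minus_1[of x] h_mult_N CARD_eq
  by (simp add: H_def mult.commute flip: power_mult)

lemma powi_N_in_H: "w powi (int N * k) \<in> H"
  using power_N_in_H[of "w powi k"] w_nonzero by (simp add: mult.commute power_int_mult)

lemma cyc_class_eq: "cyc_class w N i = (\<lambda>z. w powi i * z) ` H"
proof -
  have "H = {w powi (int N * k) |k. True}"
  proof (intro equalityI subsetI)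
    fix x assume "x \<in> H"
    then obtain k where "x = w ^ (N * k)"
      unfolding H_def roots_of_unity_eq(1)[OF h_mult_N] by blast
    then have "x = w powi (int N * int k)" by (metis of_nat_mult power_int_of_nat)
    then show "x \<in> {w powi (int N * k) |k. True}" by blast
  qed (use powi_N_in_H in auto)
  then show ?thesis using w_nonzero by (auto simp: cyc_class_def power_int_add)
qed

lemma \<gamma>_mult_H:
  assumes "u \<in> H"
  shows "\<gamma> (y * u) = \<gamma> y"
proof -
  have "u \<noteq> 0" using assms zero_notin_H by blast
  then show ?thesis unfolding \<gamma>_def
    by (intro sum.reindex_bij_witness[of _ "\<lambda>z. z / u" "\<lambda>z. u * z"])
      (use assms H_mult H_divide in \<open>auto simp: mult_ac\<close>)
qed

lemma frob_image_H: "(\<lambda>z. z ^ (p ^ k)) ` H = H"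
  by (rule endo_inj_surj) (use H_power frob_inj[of k] in \<open>auto intro: inj_on_subset\<close>)

text \<open>Frobenius powers permute \<open>H\<close> and preserve \<open>psi\<close>.\<close>

lemma \<gamma>_frob: "\<gamma> (y ^ (p ^ k)) = \<gamma> y"
proof -
  have "\<gamma> (y ^ (p ^ k)) = (\<Sum>z\<in>H. psi (y ^ (p ^ k) * z ^ (p ^ k)))"
    unfolding \<gamma>_def by (subst (1) frob_image_H[of k, symmetric], subst sum.reindex)
      (use frob_inj[of k] in \<open>auto intro: inj_on_subset\<close>)
  also have "\<dots> = \<gamma> y" by (simp add: \<gamma>_def psi_frob flip: power_mult_distrib)
  finally show ?thesis .
qed

section \<open>Periods count trace-zero elements\<close>

definition K :: "'a set" where "K = {x. x ^ q = x}"

lemma K_eq: "K = insert 0 {x. x ^ (q - 1) = 1}"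
proof -
  have "x ^ q = x * x ^ (q - 1)" for x :: 'a using q_ge_2 by (simp flip: power_Suc)
  then show ?thesis by (auto simp: K_def)
qed

lemma card_K: "card (K - {0}) = q - 1" "card K = q"
proof -
  obtain e where "(q - 1) * e = p ^ n - 1" using q_minus_1_dvd card_eq_qm by (metis dvdE)
  then have c: "card {x::'a. x ^ (q - 1) = 1} = q - 1" by (rule roots_of_unity_eq(2))
  have "(0::'a) \<notin> {x. x ^ (q - 1) = 1}" using q_ge_2 by (simp add: power_0_left)
  then show "card (K - {0}) = q - 1" "card K = q" using c q_ge_2 by (simp_all add: K_eq)
qed

text \<open>Exponents split as \<open>i + f * l\<close>, so the absolute trace factors through the
  subfield; \<open>c\<close> is fixed by powers of \<open>q\<close> and leaves the inner
  trace.\<close>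

lemma trace_transitive:
  assumes "c \<in> K"
  shows "Tr (c * x) = rel_trace p f (c * rel_trace q m x)"
proof -
  have c: "c ^ (q ^ l) = c" for l
    by (induction l) (use assms in \<open>simp_all add: K_def power_mult\<close>)
  have bound: "i + l * f < f * m" if "i < f" "l < m" for i l
  proof -
    have "i + l * f < Suc l * f" using that by simp
    also have "\<dots> \<le> m * f" using that by (intro mult_le_mono1) simp
    finally show ?thesis by (simp add: mult.commute)
  qed
  have "Tr (c * x) = (\<Sum>i<f * m. (c * x) ^ (p ^ i))" by (simp add: rel_trace_def n_eq)
  also have "\<dots> = (\<Sum>(i, l)\<in>{..<f} \<times> {..<m}. (c * x) ^ (p ^ (i + f * l)))"
    by (rule sum.reindex_bij_witness[of _ "\<lambda>(i, l). i + f * l" "\<lambda>i. (i mod f, i div f)"])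
      (use f_pos in \<open>auto simp: less_mult_imp_div_less mult.commute intro: bound\<close>)
  also have "\<dots> = (\<Sum>i<f. \<Sum>l<m. ((c * x) ^ (q ^ l)) ^ (p ^ i))"
    by (simp add: sum.cartesian_product q_eq power_add mult.commute flip: power_mult)
  also have "\<dots> = rel_trace p f (c * rel_trace q m x)"
    by (simp add: power_mult_distrib c rel_trace_def frob_sum sum_distrib_left)
  finally show ?thesis .
qed

text \<open>The map \<open>c \<mapsto> psi (c * x)\<close> is an additive character of
  \<open>K\<close>, trivial exactly when the relative trace of \<open>x\<close> vanishes. The -1
  accounts for the omitted \<open>c = 0\<close>.\<close>

lemma sum_psi_K:
  "(\<Sum>c\<in>K - {0}. psi (c * x)) = (if rel_trace q m x = 0 then of_nat q else 0) - 1"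
proof (cases "rel_trace q m x = 0")
  case True
  have "psi (c * x) = 1" if "c \<in> K" for c
  proof -
    have "Tr (c * x) = of_nat 0" using trace_transitive[OF that] True
      using p_ge_2 by (simp add: rel_trace_def power_0_left)
    from psi_eq[OF this] show ?thesis by simp
  qed
  then show ?thesis using True q_ge_2 card_K by (simp add: of_nat_diff)
next
  case False
  let ?t = "rel_trace q m x"
  have K_add: "a \<in> K \<Longrightarrow> b \<in> K \<Longrightarrow> a + b \<in> K" for a b
    using frob_add[of a b f] by (simp add: K_def flip: q_eq)
  have "x ^ ((p ^ f) ^ m) = x" using power_CARD[of x] by (simp add: n_eq power_mult)
  then have t: "?t \<in> K" using rel_trace_power[of x f m] by (simp add: K_def flip: q_eq)
  \<comment> \<open>Scaling \<open>x\<close> by \<open>a / ?t\<close> gives it relative trace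
    \<open>a\<close>, hence nonzero absolute trace.\<close>
  obtain a where a: "a \<in> K" "rel_trace p f a \<noteq> 0"
    using exists_rel_trace_nonzero[of p f K] p_ge_2 f_pos card_K q_eq by auto
  have c: "a / ?t \<in> K" using a t by (simp add: K_def power_divide)
  have "Tr (a / ?t * x) \<noteq> 0" using trace_transitive[OF c, of x] False a by simp
  moreover have "a / ?t * x \<in> (\<lambda>c. c * x) ` K" using c by (rule imageI)
  moreover have "y + z \<in> (\<lambda>c. c * x) ` K"
    if yz: "y \<in> (\<lambda>c. c * x) ` K" "z \<in> (\<lambda>c. c * x) ` K" for y z
  proof -
    obtain a b where "a \<in> K" "b \<in> K" "y = a * x" "z = b * x" using yz by blast
    then show ?thesis using K_add by (intro image_eqI[where x = "a + b"]) (simp_all add: distrib_right)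
  qed
  ultimately have "sum psi ((\<lambda>c. c * x) ` K) = 0" by (intro sum_psi_eq_0)
  moreover have "x \<noteq> 0" using False q_ge_2 by (auto simp: rel_trace_def power_0_left)
  then have "inj_on (\<lambda>c. c * x) K" by (auto simp: inj_on_def)
  ultimately have "(\<Sum>c\<in>K. psi (c * x)) = 0" by (simp add: sum.reindex)
  moreover have "0 \<in> K" using q_ge_2 by (simp add: K_def power_0_left)
  ultimately show ?thesis using False sum.remove[of K 0 "\<lambda>c. psi (c * x)"]
    by (simp add: psi_0 eq_neg_iff_add_eq_0 add.commute)
qed

text \<open>The scalars in \<open>K - {0}\<close> do not change \<open>\<gamma>\<close>; summing
  over them turns the period into a count of zero relative traces.\<close>

lemma \<gamma>_count:
  "of_nat (q - 1) * \<gamma> y = of_nat q * of_nat (card {z\<in>H. rel_trace q m (y * z) = 0}) - of_nat h"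
proof -
  have "of_nat (q - 1) * \<gamma> y = (\<Sum>c\<in>K - {0}. \<gamma> (y * c))"
    using card_K by (simp add: \<gamma>_mult_H[OF H_subfield] K_def)
  also have "\<dots> = (\<Sum>z\<in>H. \<Sum>c\<in>K - {0}. psi (c * (y * z)))"
    unfolding \<gamma>_def by (subst sum.swap) (simp add: mult_ac)
  also have "\<dots> = (\<Sum>z\<in>H. if rel_trace q m (y * z) = 0 then of_nat q else 0) - of_nat h"
    by (simp add: sum_psi_K sum_subtractf card_H)
  also have "(\<Sum>z\<in>H. if rel_trace q m (y * z) = 0 then of_nat q else 0)
      = of_nat q * (of_nat (card {z\<in>H. rel_trace q m (y * z) = 0}) :: complex)"
    by (simp add: sum.If_cases Collect_conj_eq mult.commute)
  finally show ?thesis .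
qed

text \<open>The count says \<open>\<gamma> (w powi i) = q * sub_n w q m N i - h / (q - 1)\<close>,
  an injective affine relation, so the subdifference set can be read off from the periods.\<close>

lemma sub_n_eq_iff: "sub_n w q m N i = sub_n w q m N j \<longleftrightarrow> \<gamma> (w powi i) = \<gamma> (w powi j)"
proof -
  have *: "sub_n w q m N i = real (card {z\<in>H. rel_trace q m (w powi i * z) = 0}) / real (q - 1)" for i
  proof -
    have "{x \<in> cyc_class w N i. rel_trace q m x = 0}
        = (\<lambda>z. w powi i * z) ` {z\<in>H. rel_trace q m (w powi i * z) = 0}"
      by (auto simp: cyc_class_eq)
    then show ?thesis unfolding sub_n_def
      by (simp add: card_image inj_on_def w_nonzero)
  qed
  have "of_nat (q - 1) \<noteq> (0::complex)" using q_ge_2 by simp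
  then have "\<gamma> (w powi i) = \<gamma> (w powi j) \<longleftrightarrow> of_nat (q - 1) * \<gamma> (w powi i) = of_nat (q - 1) * \<gamma> (w powi j)"
    by simp
  then show ?thesis unfolding \<gamma>_count * using q_ge_2 by simp
qed

end

section \<open>Strong regularity and the two periods\<close>

locale cyclotomic_srg = cyclotomic +
  assumes srg: "srg_cayley (cyc_class w N 0)"
    and minus_two: "\<exists>j::nat. (int p ^ j) mod int N = (- 2) mod int N"
begin

lemma cyc_class_0: "cyc_class w N 0 = H"
  by (simp add: cyc_class_eq)

lemma \<gamma>_minus: "\<gamma> (- y) = \<gamma> y"
  unfolding \<gamma>_def by (rule sum.reindex_bij_witness[of _ uminus uminus]) (auto simp: H_minus)

text \<open>Evenness of \<open>\<gamma>\<close> turns the square into a sum over differences of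
  elements of \<open>H\<close>; the multiplicity of \<open>d\<close> is the number of common
  neighbours of \<open>d\<close> and 0.\<close>

lemma \<gamma>_power2:
  "(\<gamma> y) ^ 2 = (\<Sum>d\<in>UNIV. of_nat (card {z. d - z \<in> H \<and> 0 - z \<in> H}) * psi (y * d))"
proof -
  have card: "card {ab \<in> H \<times> H. fst ab - snd ab = d} = card {z. d - z \<in> H \<and> 0 - z \<in> H}" for d
    by (rule bij_betw_same_card[of "\<lambda>ab. - snd ab"],
        rule bij_betw_byWitness[where f' = "\<lambda>z. (d - z, - z)"]) auto
  have "(\<gamma> y) ^ 2 = \<gamma> y * \<gamma> (- y)" by (simp add: \<gamma>_minus power2_eq_square)
  also have "\<dots> = (\<Sum>ab\<in>H \<times> H. psi (y * (fst ab - snd ab)))"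
    by (simp add: \<gamma>_def sum_product sum.cartesian_product case_prod_unfold algebra_simps flip: psi_add)
  also have "\<dots> = (\<Sum>d\<in>UNIV. \<Sum>ab\<in>{ab \<in> H \<times> H. fst ab - snd ab = d}. psi (y * (fst ab - snd ab)))"
    by (rule sum.group[symmetric]) auto
  also have "\<dots> = (\<Sum>d\<in>UNIV. of_nat (card {ab \<in> H \<times> H. fst ab - snd ab = d}) * psi (y * d))"
    by (rule sum.cong) auto
  finally show ?thesis unfolding card .
qed

lemma \<gamma>_quadratic:
  obtains A B :: int where "\<And>y. y \<noteq> 0 \<Longrightarrow> (\<gamma> y) ^ 2 = of_int A + of_int B * \<gamma> y"
proof -
  obtain lam mu :: nat where
    lam: "x \<noteq> y \<Longrightarrow> x - y \<in> H \<Longrightarrow> card {z. x - z \<in> H \<and> y - z \<in> H} = lam" and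
    mu: "x \<noteq> y \<Longrightarrow> x - y \<notin> H \<Longrightarrow> card {z. x - z \<in> H \<and> y - z \<in> H} = mu" for x y
    using srg unfolding srg_cayley_def cyc_class_0 by metis
  have "card {z. 0 - z \<in> H \<and> 0 - z \<in> H} = h" using H_minus by (simp add: card_H)
  \<comment> \<open>The count is \<open>mu\<close>, corrected on \<open>H\<close> and at 0, where it
    is the valency \<open>h\<close>. The constant part contributes nothing to the sum when
    \<open>y \<noteq> 0\<close>.\<close>
  then have c: "of_nat (card {z. d - z \<in> H \<and> 0 - z \<in> H})
      = (of_nat mu + (if d \<in> H then of_nat lam - of_nat mu else 0)
        + (if d = 0 then of_nat h - of_nat mu else 0) :: complex)" for d
    using lam[of d 0] mu[of d 0] zero_notin_H by auto
  have "(\<gamma> y) ^ 2 = of_int (int h - int mu) + of_int (int lam - int mu) * \<gamma> y" if "y \<noteq> 0" for y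
  proof -
    have "(\<gamma> y) ^ 2 = of_nat mu * (\<Sum>d\<in>UNIV. psi (y * d))
        + (of_nat lam - of_nat mu) * (\<Sum>d\<in>UNIV. if d \<in> H then psi (y * d) else 0)
        + (of_nat h - of_nat mu) * (\<Sum>d\<in>UNIV. if d = 0 then psi (y * d) else 0)"
      unfolding \<gamma>_power2 c sum_distrib_left sum.distrib[symmetric]
      by (rule sum.cong) (auto simp: algebra_simps)
    also have "(\<Sum>d\<in>UNIV. if d \<in> H then psi (y * d) else 0) = \<gamma> y"
      by (simp add: \<gamma>_def sum.If_cases)
    finally show ?thesis using sum_psi_mult_UNIV[OF that] by (simp add: psi_0)
  qed
  then show ?thesis by (rule that)
qed

text \<open>A constant period would be \<open>-1/N\<close>, which is not an algebraic integer.\<close>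

lemma \<gamma>_nonconstant: "\<exists>y. y \<noteq> 0 \<and> \<gamma> y \<noteq> \<gamma> 1"
proof (rule ccontr)
  assume "\<not> ?thesis"
  then have const: "\<And>y. y \<noteq> 0 \<Longrightarrow> \<gamma> y = \<gamma> 1" by blast
  have "of_nat (p ^ n - 1) * \<gamma> 1 = (\<Sum>y\<in>UNIV - {0::'a}. \<gamma> 1)"
    by (simp add: CARD_eq card_Diff_subset)
  also have "\<dots> = (\<Sum>y\<in>UNIV - {0}. \<gamma> y)"
    by (rule sum.cong[OF refl], rule const[symmetric]) simp
  also have "\<dots> = (\<Sum>z\<in>H. \<Sum>y\<in>UNIV - {0}. psi (z * y))"
    unfolding \<gamma>_def by (subst sum.swap) (simp add: mult.commute)
  also have "\<dots> = (\<Sum>z\<in>H. - 1)"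
    by (rule sum.cong[OF refl], rule sum_psi_scaled) (use zero_notin_H in blast)
  also have "\<dots> = - of_nat h" by (simp add: card_H)
  also have "of_nat (p ^ n - 1) * \<gamma> 1 = of_nat h * (of_nat N * \<gamma> 1)"
    unfolding h_mult_N[symmetric] of_nat_mult by (rule mult.assoc)
  finally have "of_nat h * (of_nat N * \<gamma> 1) = of_nat h * (- 1)" by simp
  moreover have "of_nat h \<noteq> (0 :: complex)" using h_pos by simp
  ultimately have g: "of_nat N * \<gamma> 1 = - 1" using mult_left_cancel by blast
  obtain A B :: int where AB: "\<And>y. y \<noteq> 0 \<Longrightarrow> (\<gamma> y) ^ 2 = of_int A + of_int B * \<gamma> y"
    by (rule \<gamma>_quadratic) blast
  \<comment> \<open>Multiplying the quadratic equation by \<open>N ^ 2\<close> makes every term an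
    integer and exhibits \<open>N\<close> as a divisor of 1.\<close>
  have "1 = (of_nat N * \<gamma> 1) ^ 2" unfolding g by simp
  also have "\<dots> = of_nat N * (of_nat N * (\<gamma> 1) ^ 2)" by (simp only: power2_eq_square mult_ac)
  also have "\<dots> = of_nat N * (of_nat N * of_int A + of_int B * (of_nat N * \<gamma> 1))"
    by (simp only: AB[OF one_neq_zero] ring_distribs mult_ac)
  also have "\<dots> = of_int (int N * (int N * A - B))" unfolding g by simp
  finally have "of_int 1 = (of_int (int N * (int N * A - B)) :: complex)" by simp
  then have "1 = int N * (int N * A - B)" by (simp only: of_int_eq_iff)
  then have "int N dvd 1" by (rule dvdI)
  then show False using N_ge_2 by simp
qed

text \<open>A period other than \<open>\<gamma> 1\<close> is the second root of the same monic
  quadratic, hence equals \<open>B - \<gamma> 1\<close>.\<close>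

lemma two_periods:
  obtains b where "b \<noteq> \<gamma> 1" "\<exists>y. y \<noteq> 0 \<and> \<gamma> y = b" "\<And>y. y \<noteq> 0 \<Longrightarrow> \<gamma> y = \<gamma> 1 \<or> \<gamma> y = b"
proof -
  obtain A B :: int where AB: "\<And>y. y \<noteq> 0 \<Longrightarrow> (\<gamma> y) ^ 2 = of_int A + of_int B * \<gamma> y"
    by (rule \<gamma>_quadratic) blast
  have sum: "\<gamma> y + \<gamma> 1 = of_int B" if "y \<noteq> 0" "\<gamma> y \<noteq> \<gamma> 1" for y
  proof -
    have "(\<gamma> y - \<gamma> 1) * (\<gamma> y + \<gamma> 1 - of_int B) = 0"
      using AB[of y] AB[of 1] that by (simp add: power2_eq_square algebra_simps)
    then show ?thesis using that by simp
  qed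
  obtain y0 where y0: "y0 \<noteq> 0" "\<gamma> y0 \<noteq> \<gamma> 1" using \<gamma>_nonconstant by blast
  have "\<gamma> y = \<gamma> 1 \<or> \<gamma> y = \<gamma> y0" if "y \<noteq> 0" for y
    using sum[OF that] sum[OF y0] by (metis add_right_cancel)
  then show ?thesis using y0 by (intro that[of "\<gamma> y0"]) auto
qed

lemma \<gamma>_powi_mod: "\<gamma> (w powi (i mod int N)) = \<gamma> (w powi i)"
proof -
  have "w powi i = w powi (i mod int N) * w powi (int N * (i div int N))"
    using w_nonzero by (simp flip: power_int_add)
  then show ?thesis using \<gamma>_mult_H[OF powi_N_in_H] by metis
qed

text \<open>With exactly two periods, all nonzero differences share one value, so the definite
  description in \<open>subdiff_set\<close> is meaningful.\<close>

lemma mem_subdiff_set: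
  "i \<in> subdiff_set w q m N \<longleftrightarrow> i \<in> {0..<int N} \<and> \<gamma> (w powi i) \<noteq> \<gamma> 1"
proof -
  obtain b where b: "b \<noteq> \<gamma> 1" "\<exists>y. y \<noteq> 0 \<and> \<gamma> y = b" "\<And>y. y \<noteq> 0 \<Longrightarrow> \<gamma> y = \<gamma> 1 \<or> \<gamma> y = b"
    by (rule two_periods) blast
  define D where "D = (\<lambda>i. sub_n w q m N i - sub_n w q m N 0)"
  obtain y where "y \<noteq> 0" "\<gamma> y = b" using b by blast
  then obtain k where "\<gamma> (w powi k) = b" using primitive_element_powi[OF prim] by metis
  then have i0: "\<gamma> (w powi (k mod int N)) = b" by (simp add: \<gamma>_powi_mod)
  have D0: "D i \<noteq> 0 \<longleftrightarrow> \<gamma> (w powi i) \<noteq> \<gamma> 1" for i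
    using sub_n_eq_iff[of i 0] by (simp add: D_def)
  have D_eq: "D i = D (k mod int N)" if "D i \<noteq> 0" for i
    using that b(3)[of "w powi i"] i0 sub_n_eq_iff[of i "k mod int N"] w_nonzero
    unfolding D0 by (auto simp: D_def)
  have Dk: "D (k mod int N) \<noteq> 0" unfolding D0 using i0 b by simp
  have "(THE d. d \<noteq> 0 \<and> (\<exists>i\<in>{0..<int N}. D i = d)) = D (k mod int N)"
  proof (rule the_equality)
    have "k mod int N \<in> {0..<int N}" using N_ge_2 by simp
    then show "D (k mod int N) \<noteq> 0 \<and> (\<exists>i\<in>{0..<int N}. D i = D (k mod int N))" using Dk by blast
  qed (use D_eq in blast)
  then have "subdiff_set w q m N = {i \<in> {0..<int N}. D i = D (k mod int N)}"
    by (simp add: subdiff_set_def D_def)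
  moreover have "D i = D (k mod int N) \<longleftrightarrow> \<gamma> (w powi i) \<noteq> \<gamma> 1" using D_eq[of i] Dk D0[of i] by metis
  ultimately show ?thesis by simp
qed

section \<open>The Frobenius power acting as inversion of squares\<close>

text \<open>From \<open>p ^ s\<close> congruent to -2 modulo \<open>N\<close>, the exponent
  \<open>p ^ s + 2\<close> is a multiple of \<open>N\<close>, and \<open>N\<close>-th powers lie in
  \<open>H\<close>.\<close>

lemma frob_inverse_square:
  obtains s where "\<And>x::'a. x \<noteq> 0 \<Longrightarrow> x ^ (p ^ s) * x ^ 2 \<in> H"
proof -
  obtain s where "(int p ^ s) mod int N = (- 2) mod int N" using minus_two by blast
  then have "int N dvd int (p ^ s + 2)" by (simp add: mod_eq_dvd_iff add.commute)
  then have "N dvd p ^ s + 2" by (simp only: int_dvd_int_iff)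
  then obtain t where t: "p ^ s + 2 = N * t" ..
  have "x ^ (p ^ s) * x ^ 2 \<in> H" if "x \<noteq> 0" for x
  proof -
    have "x ^ (p ^ s) * x ^ 2 = (x ^ t) ^ N" by (metis t power_add power_mult mult.commute)
    then show ?thesis using power_N_in_H[of "x ^ t"] that by simp
  qed
  then show ?thesis by (rule that)
qed

text \<open>Frobenius replaces \<open>1 / x\<close> by \<open>(1 / x) ^ (p ^ s)\<close>, which lies
  in the same coset of \<open>H\<close> as \<open>x ^ 2\<close>.\<close>

lemma \<gamma>_square:
  assumes "x \<noteq> 0"
  shows "\<gamma> (x ^ 2) = \<gamma> (1 / x)"
proof -
  obtain s where s: "\<And>x::'a. x \<noteq> 0 \<Longrightarrow> x ^ (p ^ s) * x ^ 2 \<in> H"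
    by (rule frob_inverse_square) blast
  have "\<gamma> (1 / x) = \<gamma> ((1 / x) ^ (p ^ s))" by (simp only: \<gamma>_frob)
  also have "\<dots> = \<gamma> ((1 / x) ^ (p ^ s) * (x ^ (p ^ s) * x ^ 2))" using s[OF assms] by (simp only: \<gamma>_mult_H)
  also have "(1 / x) ^ (p ^ s) * (x ^ (p ^ s) * x ^ 2) = x ^ 2"
    using assms by (simp add: power_divide)
  finally show ?thesis ..
qed

text \<open>The quadratic condition on \<open>u\<close> is traded for the condition
  \<open>y * u ^ (p ^ s) \<in> H\<close>; as \<open>psi\<close> is Frobenius invariant, the sum then
  runs over \<open>H\<close> divided by \<open>y\<close>.\<close>

lemma sum_psi_square_roots:
  assumes "y \<noteq> 0"
  shows "(\<Sum>u\<in>{u. u ^ 2 / (4 * y) \<in> H}. psi u) = \<gamma> (1 / y)"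
proof -
  obtain s where s: "\<And>x::'a. x \<noteq> 0 \<Longrightarrow> x ^ (p ^ s) * x ^ 2 \<in> H"
    by (rule frob_inverse_square) blast
  have iff: "u ^ 2 / (4 * y) \<in> H \<longleftrightarrow> y * u ^ (p ^ s) \<in> H" for u
  proof (cases "u = 0")
    case False
    define e where "e = u ^ (p ^ s) * u ^ 2"
    have e: "e \<in> H" "e / 4 \<in> H" using s[OF False] four_in_H H_divide by (auto simp: e_def)
    \<comment> \<open>The two elements to be compared have product \<open>e / 4\<close>, which lies
      in \<open>H\<close>.\<close>
    have "(e / 4) / (u ^ 2 / (4 * y)) = y * u ^ (p ^ s)"
         "(e / 4) / (y * u ^ (p ^ s)) = u ^ 2 / (4 * y)"
      using False assms four_nonzero by (simp_all add: e_def)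
    then show ?thesis using H_divide[OF e(2)] by metis
  qed (use zero_notin_H p_ge_2 in \<open>simp add: power_0_left\<close>)
  have surj: "surj (\<lambda>u::'a. u ^ (p ^ s))" by (rule finite_UNIV_inj_surj[OF finite frob_inj])
  have "v \<in> (\<lambda>z. z / y) ` H \<longleftrightarrow> y * v \<in> H" for v
  proof
    show "v \<in> (\<lambda>z. z / y) ` H" if "y * v \<in> H"
      by (rule image_eqI[OF _ that]) (use assms in simp)
  qed (use assms in auto)
  then have img: "{u. u ^ 2 / (4 * y) \<in> H} = (\<lambda>u. u ^ (p ^ s)) -` ((\<lambda>z. z / y) ` H)"
    by (simp add: vimage_def iff)
  have "(\<Sum>u\<in>{u. u ^ 2 / (4 * y) \<in> H}. psi u) = (\<Sum>u\<in>{u. u ^ 2 / (4 * y) \<in> H}. psi (u ^ (p ^ s)))"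
    by (simp add: psi_frob)
  also have "\<dots> = sum psi ((\<lambda>u. u ^ (p ^ s)) ` {u. u ^ 2 / (4 * y) \<in> H})"
    by (subst sum.reindex) (use frob_inj[of s] in \<open>auto intro: inj_on_subset\<close>)
  also have "(\<lambda>u. u ^ (p ^ s)) ` {u. u ^ 2 / (4 * y) \<in> H} = (\<lambda>z. z / y) ` H"
    unfolding img using surj by (rule surj_image_vimage_eq)
  also have "sum psi ((\<lambda>z. z / y) ` H) = \<gamma> (1 / y)"
    unfolding \<gamma>_def by (subst sum.reindex) (use assms in \<open>auto simp: inj_on_def\<close>)
  finally show ?thesis .
qed

text \<open>Expanding the period gives Salie sums with \<open>v = y * z\<close>; the roots of
  \<open>u ^ 2 = 4 * (y * z)\<close>, over all \<open>z \<in> H\<close>, together form the set of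
  the preceding lemma.\<close>

lemma sum_quad_char_period:
  assumes "y \<noteq> 0"
  shows "(\<Sum>x\<in>UNIV - {0}. quad_char x * psi x * \<gamma> (y / x)) = gauss_quad p n TYPE('a) * \<gamma> (1 / y)"
proof -
  have "(\<Sum>x\<in>UNIV - {0}. quad_char x * psi x * \<gamma> (y / x))
      = (\<Sum>z\<in>H. \<Sum>x\<in>UNIV - {0}. quad_char x * psi (x + (y * z) / x))"
    unfolding \<gamma>_def sum_distrib_left by (subst sum.swap) (simp add: psi_add mult_ac)
  also have "\<dots> = (\<Sum>z\<in>H. gauss_quad p n TYPE('a) * (\<Sum>u\<in>{u. u ^ 2 = 4 * (y * z)}. psi u))"
    by (rule sum.cong[OF refl], rule salie) (use assms zero_notin_H in auto)
  also have "\<dots> = gauss_quad p n TYPE('a)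
      * (\<Sum>z\<in>H. \<Sum>u\<in>{u \<in> {u. u ^ 2 / (4 * y) \<in> H}. u ^ 2 / (4 * y) = z}. psi u)"
    unfolding sum_distrib_left
    by (intro sum.cong refl) (use assms four_nonzero in \<open>auto simp: field_simps\<close>)
  also have "\<dots> = gauss_quad p n TYPE('a) * (\<Sum>u\<in>{u. u ^ 2 / (4 * y) \<in> H}. psi u)"
    by (subst sum.group) auto
  finally show ?thesis by (simp only: sum_psi_square_roots[OF assms])
qed


section \<open>The union of classes\<close>

text \<open>In terms of periods, \<open>D\<close> is the union of the classes \<open>C_t\<close> with \<open>2t \<notin> I\<close>.\<close>

definition D :: "'a set" where "D = {x. x \<noteq> 0 \<and> \<gamma> (1 / x) = \<gamma> 1}"

lemma powi_double: "w powi (2 * k) = (w powi k) ^ 2"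
  unfolding mult_2 power2_eq_square by (rule power_int_add) (simp add: w_nonzero)

text \<open>Doubling an index squares the element, and \<open>\<gamma>_square\<close> turns the
  square into an inverse.\<close>

lemma \<gamma>_double: "\<gamma> (w powi ((2 * t) mod int N)) = \<gamma> (w powi (- t))"
  unfolding \<gamma>_powi_mod powi_double power_int_minus_divide
  by (rule \<gamma>_square) (simp add: w_nonzero)

lemma class_index_mem:
  "(2 * t) mod int N \<in> subdiff_set w q m N \<longleftrightarrow> \<gamma> (w powi (- t)) \<noteq> \<gamma> 1"
  using N_ge_2 by (simp add: mem_subdiff_set \<gamma>_double)

lemma \<gamma>_inverse_class: "z \<in> H \<Longrightarrow> \<gamma> (1 / (w powi t * z)) = \<gamma> (w powi (- t))"
  using \<gamma>_mult_H[of "1 / z" "w powi (- t)"] H_divide[OF one_in_H, of z]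
  by (simp add: power_int_minus_divide)

lemma union_classes:
  "(\<Union>t\<in>{0..<int N} - {u \<in> {0..<int N}. (2 * u) mod int N \<in> subdiff_set w q m N}. cyc_class w N t) = D"
proof (intro equalityI subsetI)
  fix x
  assume "x \<in> (\<Union>t\<in>{0..<int N} - {u \<in> {0..<int N}. (2 * u) mod int N \<in> subdiff_set w q m N}. cyc_class w N t)"
  then obtain t z where "x = w powi t * z" "z \<in> H" "\<gamma> (w powi (- t)) = \<gamma> 1"
    unfolding cyc_class_eq using class_index_mem by blast
  then show "x \<in> D"
    using zero_notin_H w_nonzero by (auto simp: D_def \<gamma>_inverse_class)
next
  fix x assume x: "x \<in> D"
  then obtain k where k: "x = w powi k" using primitive_element_powi[OF prim, of x] by (auto simp: D_def)
  define t where "t = k mod int N"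
  have t: "t \<in> {0..<int N}" using N_ge_2 by (simp add: t_def)
  have z: "w powi (int N * (k div int N)) \<in> H" by (rule powi_N_in_H)
  have "k = t + int N * (k div int N)" by (simp add: t_def)
  then have xt: "x = w powi t * w powi (int N * (k div int N))"
    using w_nonzero power_int_add k by metis
  have "\<gamma> (1 / x) = \<gamma> 1" using x by (simp add: D_def)
  then have "\<gamma> (w powi (- t)) = \<gamma> 1" unfolding xt \<gamma>_inverse_class[OF z] .
  moreover have "x \<in> cyc_class w N t" unfolding cyc_class_eq using xt z by blast
  ultimately show "x \<in> (\<Union>t\<in>{0..<int N} - {u \<in> {0..<int N}. (2 * u) mod int N \<in> subdiff_set w q m N}. cyc_class w N t)"
    using t class_index_mem[of t] by blast
qed

text \<open>Elements of these classes are squares of \<open>w powi (t + int N * k)\<close>. They lie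
  in the \<open>N\<close>-class of index \<open>2 * t\<close>, so the test for \<open>D\<close>
  concerns the doubled index \<open>4 * t\<close>.\<close>

lemma union_square_classes:
  "(\<Union>t\<in>{(2 * t) mod (2 * int N) | t. t \<in> {0..<int N} \<and> (4 * t) mod int N \<notin> subdiff_set w q m N}.
      cyc_class w (2 * N) t) = {x \<in> D. \<exists>r. x = r ^ 2}"
proof (intro equalityI subsetI)
  fix x
  assume "x \<in> (\<Union>t\<in>{(2 * t) mod (2 * int N) | t. t \<in> {0..<int N} \<and> (4 * t) mod int N \<notin> subdiff_set w q m N}.
      cyc_class w (2 * N) t)"
  then obtain t k where t: "t \<in> {0..<int N}" "(4 * t) mod int N \<notin> subdiff_set w q m N"
    and "x = w powi ((2 * t) mod (2 * int N) + int (2 * N) * k)"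
    unfolding cyc_class_def by blast
  then have x: "x = w powi (2 * t + int N * (2 * k))" by (simp add: mult_ac)
  then have "x = w powi (2 * t) * w powi (int N * (2 * k))" using w_nonzero by (simp add: power_int_add)
  then have "\<gamma> (1 / x) = \<gamma> 1"
    using t class_index_mem[of "2 * t"] by (simp add: \<gamma>_inverse_class[OF powi_N_in_H])
  moreover have "x = (w powi (t + int N * k)) ^ 2"
    unfolding x powi_double[symmetric] by (simp add: algebra_simps)
  moreover have "x \<noteq> 0" using x w_nonzero by simp
  ultimately show "x \<in> {x \<in> D. \<exists>r. x = r ^ 2}" unfolding D_def by blast
next
  fix x assume "x \<in> {x \<in> D. \<exists>r. x = r ^ 2}"
  then obtain r where r: "x = r ^ 2" "r \<noteq> 0" "\<gamma> (1 / x) = \<gamma> 1" by (auto simp: D_def)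
  then obtain k where k: "r = w powi k" using primitive_element_powi[OF prim, of r] by auto
  define t where "t = k mod int N"
  have t: "t \<in> {0..<int N}" using N_ge_2 by (simp add: t_def)
  have "k = t + int N * (k div int N)" by (simp add: t_def)
  moreover have x: "x = w powi (2 * k)"
    unfolding r k powi_double ..
  ultimately have xt: "x = w powi (2 * t + int N * (2 * (k div int N)))"
    by (metis mult.left_commute distrib_left)
  then have "x = w powi (2 * t) * w powi (int N * (2 * (k div int N)))"
    using w_nonzero by (simp add: power_int_add)
  then have "\<gamma> (w powi (- (2 * t))) = \<gamma> 1"
    using r(3) \<gamma>_inverse_class[OF powi_N_in_H] by metis
  then have "(4 * t) mod int N \<notin> subdiff_set w q m N" using class_index_mem[of "2 * t"] by simp
  moreover have "x \<in> cyc_class w (2 * N) ((2 * t) mod (2 * int N))"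
    using t unfolding cyc_class_def xt by (auto intro!: exI[of _ "k div int N"] simp: mult_ac)
  ultimately show "x \<in> (\<Union>t\<in>{(2 * t) mod (2 * int N) | t. t \<in> {0..<int N} \<and> (4 * t) mod int N \<notin> subdiff_set w q m N}.
      cyc_class w (2 * N) t)" using t by blast
qed

text \<open>The function \<open>b - \<gamma> (1 / x)\<close> is \<open>b - \<gamma> 1\<close> on
  \<open>D\<close> and 0 at other nonzero \<open>x\<close>, so it serves as a scaled indicator and
  reduces the sum to a Gauss sum and \<open>sum_quad_char_period\<close>.\<close>

lemma sum_quad_char_D:
  assumes "y \<noteq> 0"
  shows "(\<Sum>x\<in>D. quad_char x * psi (y * x))
    = (if \<gamma> (1 / y) = \<gamma> 1 then quad_char y * gauss_quad p n TYPE('a) else 0)"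
proof -
  obtain b where b: "b \<noteq> \<gamma> 1" "\<And>y. y \<noteq> 0 \<Longrightarrow> \<gamma> y = \<gamma> 1 \<or> \<gamma> y = b"
    by (rule two_periods) blast
  let ?G = "gauss_quad p n TYPE('a)"
  have "(b - \<gamma> 1) * (\<Sum>x\<in>D. quad_char x * psi (y * x))
      = (\<Sum>x\<in>UNIV - {0}. (b - \<gamma> (1 / x)) * (quad_char x * psi (y * x)))"
  proof -
    have "(\<Sum>x\<in>UNIV - {0}. (b - \<gamma> (1 / x)) * (quad_char x * psi (y * x)))
        = (\<Sum>x\<in>D. (b - \<gamma> (1 / x)) * (quad_char x * psi (y * x)))"
    proof (rule sum.mono_neutral_right)
      have "\<gamma> (1 / x) = b" if "x \<in> UNIV - {0} - D" for x
        using that b(2)[of "1 / x"] by (auto simp: D_def)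
      then show "\<forall>x\<in>UNIV - {0} - D. (b - \<gamma> (1 / x)) * (quad_char x * psi (y * x)) = 0" by simp
    qed (auto simp: D_def)
    also have "\<dots> = (\<Sum>x\<in>D. (b - \<gamma> 1) * (quad_char x * psi (y * x)))"
      by (rule sum.cong) (auto simp: D_def)
    finally show ?thesis by (simp add: sum_distrib_left)
  qed
  also have "\<dots> = (\<Sum>x\<in>UNIV - {0}. quad_char y * ((b - \<gamma> (y / x)) * (quad_char x * psi x)))"
  proof (rule sum.reindex_bij_witness[of _ "\<lambda>x. x / y" "\<lambda>x. y * x"])
    fix x :: 'a assume "x \<in> UNIV - {0}"
    have "quad_char y * quad_char (y * x) = quad_char x"
      using quad_char_cases[OF assms] by (auto simp: quad_char_mult)
    moreover have "quad_char y * (B * (quad_char (y * x) * P)) = B * ((quad_char y * quad_char (y * x)) * P)"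
      for B P by (simp only: mult_ac)
    ultimately show "quad_char y * ((b - \<gamma> (y / (y * x))) * (quad_char (y * x) * psi (y * x)))
        = (b - \<gamma> (1 / x)) * (quad_char x * psi (y * x))"
      using assms by simp
  qed (use assms in auto)
  also have "\<dots> = quad_char y * (b * (\<Sum>x\<in>UNIV - {0}. quad_char x * psi x)
      - (\<Sum>x\<in>UNIV - {0}. quad_char x * psi x * \<gamma> (y / x)))"
    unfolding sum_distrib_left sum_subtractf[symmetric]
    by (rule sum.cong[OF refl]) (simp add: algebra_simps)
  also have "\<dots> = quad_char y * ?G * (b - \<gamma> (1 / y))"
    unfolding sum_quad_char_period[OF assms] by (simp add: gauss_quad_def algebra_simps)
  \<comment> \<open>The dichotomy applies again at \<open>1 / y\<close>: the factor
    \<open>b - \<gamma> (1 / y)\<close> is either \<open>b - \<gamma> 1\<close> or 0.\<close>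
  also have "\<dots> = (b - \<gamma> 1) * (if \<gamma> (1 / y) = \<gamma> 1 then quad_char y * ?G else 0)"
    using b(2)[of "1 / y"] assms by auto
  finally show ?thesis using b(1) by simp
qed

text \<open>On nonzero elements, twice the indicator of squares minus 1 is
  \<open>quad_char\<close>.\<close>

lemma twice_squares_minus_all:
  assumes "y \<noteq> 0"
  shows "2 * add_char_set p n ((\<lambda>x. y * x) ` {x \<in> D. \<exists>r. x = r ^ 2}) - add_char_set p n ((\<lambda>x. y * x) ` D)
    = (\<Sum>x\<in>D. quad_char x * psi (y * x))"
proof -
  have inj: "inj_on (\<lambda>x. y * x) A" for A using assms by (simp add: inj_on_def)
  have "(\<Sum>x\<in>D. if \<exists>r. x = r ^ 2 then 2 * psi (y * x) else 0)
      = (\<Sum>x\<in>{x \<in> D. \<exists>r. x = r ^ 2}. 2 * psi (y * x))"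
    by (rule sum.inter_filter[symmetric]) simp
  then have "2 * (\<Sum>x\<in>{x \<in> D. \<exists>r. x = r ^ 2}. psi (y * x)) - (\<Sum>x\<in>D. psi (y * x))
      = (\<Sum>x\<in>D. (if \<exists>r. x = r ^ 2 then 2 * psi (y * x) else 0) - psi (y * x))"
    by (simp add: sum_subtractf sum_distrib_left)
  also have "\<dots> = (\<Sum>x\<in>D. quad_char x * psi (y * x))"
    by (rule sum.cong) (auto simp: quad_char_def D_def)
  finally show ?thesis unfolding add_char_set_def by (simp add: sum.reindex[OF inj])
qed

end

theorem theorem6p2:
  fixes p f q m N :: nat and w :: "'a::{field,finite}" and c :: int
  assumes "prime p" and "odd p" and "f \<ge> 1" and "q = p ^ f" and "m \<ge> 2"
    and "CARD('a) = q ^ m"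
    and "primitive_element w"
    and "odd N" and "N \<ge> 2" and "N dvd (q ^ m - 1) div (q - 1)"
    and "srg_cayley (cyc_class w N 0)"
    and "\<exists>j::nat. (int p ^ j) mod int N = (- 2) mod int N"
  shows
    "let I = subdiff_set w q m N;
         halfI = {u \<in> {0..<int N}. (2 * u) mod int N \<in> I};
         Xhat = {(2 * t) mod (2 * int N) | t. t \<in> {0..<int N} \<and> (4 * t) mod int N \<notin> I};
         S1 = (\<lambda>x. w powi c * x) ` (\<Union>t\<in>Xhat. cyc_class w (2 * N) t);
         S2 = (\<lambda>x. w powi c * x) ` (\<Union>t\<in>{0..<int N} - halfI. cyc_class w N t);
         V = 2 * add_char_set p (f * m) S1 - add_char_set p (f * m) S2;
         G = gauss_quad p (f * m) TYPE('a)
     in (c mod int N \<in> halfI \<longrightarrow> V = 0) \<and>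
        (c mod int N \<notin> halfI \<longrightarrow> V = G \<or> V = - G)"
proof -
  interpret cyclotomic_srg p "f * m" w q f m N
    by unfold_locales (use assms in \<open>auto simp: power_mult\<close>)
  have y: "w powi c \<noteq> 0" using w_nonzero by simp
  have "(2 * (c mod int N)) mod int N = (2 * c) mod int N" by (rule mod_mult_right_eq)
  then have half: "c mod int N \<in> {u \<in> {0..<int N}. (2 * u) mod int N \<in> subdiff_set w q m N}
      \<longleftrightarrow> \<gamma> (1 / w powi c) \<noteq> \<gamma> 1"
    using class_index_mem[of c] N_ge_2 by (simp add: power_int_minus_divide)
  \<comment> \<open>The undetermined sign is \<open>quad_char (w powi c)\<close>.\<close>
  show ?thesis
    unfolding Let_def half union_square_classes union_classes
      twice_squares_minus_all[OF y] sum_quad_char_D[OF y]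
    using quad_char_cases[OF y] by auto
qed

end
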